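(* Let $\beta>0$, $0<c<1$, $t>\ln(c)$ and $n\in\mathbb{N}$. Then for all $x$, $$M_n(x;\beta,ce^{-t})=\sum_{k=0}^n\frac{(-n)_k(-x)_k}{k!\,(\beta)_k\,c^k}\,M_{n-k}(x-k;\beta+k,c)\,(1-e^{t})^k.$$
   Context: $\mathbb N=\{0,1,2,\dots\}$, $(y)_k=y(y+1)\cdots(y+k-1)$. The Meixner polynomials are $$M_n(x;\beta,c)=\sum_{j=0}^n\frac{(-n)_j(-x)_j}{(\beta)_j\,j!}\left(\frac{c-1}{c}\right)^j,$$ polynomials of degree $n$ in $x$. *)

theory Defs
  imports Complex_Main
begin

text \<open>The library's \<^const>\<open>pochhammer\<close> is the rising factorial \<open>(y)_k = y (y+1) \<cdots> (y+k-1)\<close>.\<close>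

definition Meixner :: "nat \<Rightarrow> 'a \<Rightarrow> 'a \<Rightarrow> 'a \<Rightarrow> 'a::field_char_0" where
  "Meixner n x \<beta> c =
     (\<Sum>j=0..n. (pochhammer (- of_nat n) j * pochhammer (- x) j) / (pochhammer \<beta> j * fact j)
                * ((c - 1) / c) ^ j)"

end

theory Submission
  imports Defs
begin

text \<open>
  For fixed \<open>n\<close>, \<open>x\<close> and \<open>\<beta>\<close>, the Meixner polynomial is a polynomial in \<open>u = (c - 1) / c\<close>, and the
  identity is its Taylor expansion in this variable. Replacing \<open>c\<close> by \<open>c e\<^sup>-\<^sup>t\<close> changes \<open>u\<close> to
  \<open>1 - e\<^sup>t / c = u + (1 - e\<^sup>t) / c\<close>, so the increment is \<open>w = (1 - e\<^sup>t) / c\<close>. Expanding each power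
  \<open>(u + w)\<^sup>j\<close> binomially and collecting the coefficient of \<open>w\<^sup>k\<close>, the rule
  \<open>(y)\<^bsub>k+i\<^esub> = (y)\<^sub>k (y + k)\<^sub>i\<close> splits every Pochhammer symbol into a factor depending on \<open>k\<close> alone and
  one with shifted parameter; the shifted factors make up a Meixner polynomial with parameters
  \<open>n - k\<close>, \<open>x - k\<close> and \<open>\<beta> + k\<close>. The sums are finite, so this is an algebraic identity, valid over
  any field of characteristic zero.
\<close>

text \<open>Writing the indices as \<open>i\<close> and \<open>k\<close> with \<open>i + k = j\<close> makes the region of summation a triangle,
  over which the two orders of summation can be exchanged.\<close>

lemma sum_binomial_swap:
  fixes a :: "nat \<Rightarrow> 'a::comm_semiring_1"
  shows "(\<Sum>j=0..n. a j * (u + w) ^ j) =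
    (\<Sum>k=0..n. \<Sum>i=0..n - k. a (k + i) * of_nat ((k + i) choose k) * u ^ i * w ^ k)"
proof -
  let ?g = "\<lambda>k i. a (k + i) * of_nat ((k + i) choose k) * u ^ i * w ^ k"
  have "(\<Sum>j=0..n. a j * (u + w) ^ j) = (\<Sum>j\<le>n. \<Sum>k\<le>j. ?g k (j - k))"
    unfolding atMost_atLeast0 [symmetric]
  proof (rule sum.cong [OF refl])
    fix j
    have "a j * (u + w) ^ j = a j * (\<Sum>k\<le>j. of_nat (j choose k) * w ^ k * u ^ (j - k))"
      by (simp add: add.commute [of u w] binomial_ring)
    also have "\<dots> = (\<Sum>k\<le>j. ?g k (j - k))"
      by (simp add: sum_distrib_left mult_ac)
    finally show "a j * (u + w) ^ j = (\<Sum>k\<le>j. ?g k (j - k))" .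
  qed
  also have "\<dots> = (\<Sum>(k, i)\<in>{(k, i). k + i \<le> n}. ?g k i)"
    by (rule sum.triangle_reindex_eq [symmetric])
  also have "{(k, i). k + i \<le> n} = (SIGMA k:{0..n}. {0..n - k})"
    by auto
  also have "(\<Sum>(k, i)\<in>\<dots>. ?g k i) = (\<Sum>k=0..n. \<Sum>i=0..n - k. ?g k i)"
    by (simp add: sum.Sigma)
  finally show ?thesis .
qed

text \<open>The Taylor expansion in \<open>(c - 1) / c\<close>. Since the inverse is multiplicative even at zero, where
  its value is zero, the coefficients split in the same way when a Pochhammer symbol of \<open>\<beta>\<close>
  vanishes.\<close>

lemma Meixner_Taylor:
  fixes x \<beta> c d w :: "'a::field_char_0"
  assumes "(d - 1) / d = (c - 1) / c + w"
  shows "Meixner n x \<beta> d =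
    (\<Sum>k=0..n. (pochhammer (- of_nat n) k * pochhammer (- x) k) / (fact k * pochhammer \<beta> k)
                * Meixner (n - k) (x - of_nat k) (\<beta> + of_nat k) c * w ^ k)"
proof -
  let ?a = "\<lambda>j. (pochhammer (- of_nat n) j * pochhammer (- x) j) / (pochhammer \<beta> j * fact j) :: 'a"
  have coeff: "?a (k + i) * of_nat ((k + i) choose k) =
      (pochhammer (- of_nat n) k * pochhammer (- x) k) / (fact k * pochhammer \<beta> k)
      * ((pochhammer (- of_nat (n - k)) i * pochhammer (- (x - of_nat k)) i)
         / (pochhammer (\<beta> + of_nat k) i * fact i))" if "k \<le> n" for k i
  proof -
    have "of_nat ((k + i) choose k) = (fact (k + i) / (fact k * fact i) :: 'a)"
      by (simp add: binomial_fact)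
    moreover have "- of_nat n + of_nat k = (- of_nat (n - k) :: 'a)"
      using that by (simp add: of_nat_diff)
    moreover have "- x + of_nat k = - (x - of_nat k)"
      by simp
    ultimately show ?thesis
      by (simp only: pochhammer_product' [of _ k i]) (simp add: mult_ac)
  qed
  have "Meixner n x \<beta> d = (\<Sum>j=0..n. ?a j * ((c - 1) / c + w) ^ j)"
    by (simp only: Meixner_def assms)
  also have "\<dots> = (\<Sum>k=0..n. \<Sum>i=0..n - k.
      ?a (k + i) * of_nat ((k + i) choose k) * ((c - 1) / c) ^ i * w ^ k)"
    by (rule sum_binomial_swap)
  also have "\<dots> = (\<Sum>k=0..n.
      (pochhammer (- of_nat n) k * pochhammer (- x) k) / (fact k * pochhammer \<beta> k)
      * Meixner (n - k) (x - of_nat k) (\<beta> + of_nat k) c * w ^ k)"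
    unfolding Meixner_def sum_distrib_left sum_distrib_right
    by (intro sum.cong refl) (simp only: coeff atLeastAtMost_iff mult.assoc)
  finally show ?thesis .
qed

theorem mainTheorem17:
  fixes \<beta> c t :: real and n :: nat and x :: "'a::real_normed_field"
  assumes "\<beta> > 0" and "0 < c" and "c < 1" and "t > ln c"
  shows "Meixner n x (of_real \<beta>) (of_real (c * exp (- t))) =
    (\<Sum>k=0..n. (pochhammer (- of_nat n) k * pochhammer (- x) k)
                  / (fact k * pochhammer (of_real \<beta>) k * of_real c ^ k)
                * Meixner (n - k) (x - of_nat k) (of_real \<beta> + of_nat k) (of_real c)
                * of_real (1 - exp t) ^ k)"
proof -
  have "(c * exp (- t) - 1) / (c * exp (- t)) = (c - 1) / c + (1 - exp t) / c"
    using \<open>0 < c\<close> by (simp add: exp_minus field_simps)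
  then have "of_real ((c * exp (- t) - 1) / (c * exp (- t)))
      = (of_real ((c - 1) / c + (1 - exp t) / c) :: 'a)"
    by (rule arg_cong)
  then have "(of_real (c * exp (- t)) - 1) / of_real (c * exp (- t))
      = (of_real c - 1) / of_real c + (of_real (1 - exp t) / of_real c :: 'a)"
    by (simp only: of_real_diff of_real_divide of_real_add of_real_1)
  from Meixner_Taylor [OF this, of n x "of_real \<beta>"] show ?thesis
    by (simp add: power_divide mult_ac)
qed

end
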